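(* Let $d$ be a positive integer and $A\subseteq\mathbb{Z}^d$. If $\mathrm{Dim}_\zeta(A)<1$, then no infinite subset of $A$ is boundedly connected.
   Context: For $\vec{n}=(n_1,\dots,n_d)\in\mathbb{Z}^d$, $\|\vec{n}\|=\sqrt{n_1^2+\cdots+n_d^2}$. For $A\subseteq\mathbb{Z}^d$, $\zeta_A(s)=\sum_{\vec{0}\neq\vec{n}\in A}\|\vec{n}\|^{-s}$ for real $s\ge0$, and $\mathrm{Dim}_\zeta(A)=\inf\{s\ge0\mid\zeta_A(s)<\infty\}$. For $r\in\mathbb{Z}^+$ and $\vec{m},\vec{n}\in\mathbb{Z}^d$, an $r$-path from $\vec{m}$ to $\vec{n}$ is a finite sequence $(\vec{p}_0,\dots,\vec{p}_l)$ of points of $\mathbb{Z}^d$ with $\vec{p}_0=\vec{m}$, $\vec{p}_l=\vec{n}$, and $\|\vec{p}_i-\vec{p}_{i+1}\|\le r$ for all $0\le i<l$. A set $C\subseteq\mathbb{Z}^d$ is boundedly connected if there exists $r\in\mathbb{Z}^+$ such that for all $\vec{m},\vec{n}\in C$ there is an $r$-path from $\vec{m}$ to $\vec{n}$ all of whose points lie in $C$. *)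

theory Defs
  imports "HOL-Analysis.Analysis"
begin

text \<open>
  Lattice points of dimension \<open>d = CARD('d)\<close> are elements of the type \<open>int ^ 'd\<close>.
  This type carries no norm in the library since \<open>int\<close> is not a real normed vector space.
\<close>

definition eucl_norm :: "int ^ 'd \<Rightarrow> real" where
  "eucl_norm n = sqrt (\<Sum>i\<in>UNIV. (real_of_int (n $ i))\<^sup>2)"

text \<open>
  The series has nonnegative terms, so it is summed in \<open>ennreal\<close>, where every such sum exists
  and equals infinity exactly when the real series diverges.
\<close>

definition zeta :: "(int ^ 'd) set \<Rightarrow> real \<Rightarrow> ennreal" where
  "zeta A s = (\<Sum>\<^sub>\<infinity>n\<in>A - {0}. ennreal (eucl_norm n powr (- s)))"

text \<open>
  The infimum is taken in the extended reals, so an infimum over the empty set would be infinity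
  rather than an unspecified real. The set is in fact never empty: it contains every \<open>s > CARD('d)\<close>.
\<close>

definition Dim_zeta :: "(int ^ 'd) set \<Rightarrow> ereal" where
  "Dim_zeta A = (INF s\<in>{s. 0 \<le> s \<and> zeta A s < \<infinity>}. ereal s)"

text \<open>The sequence \<open>(p\<^sub>0, \<dots>, p\<^sub>l)\<close> is a nonempty list of length \<open>l + 1\<close>; \<open>l = 0\<close> is allowed.\<close>

definition r_path :: "nat \<Rightarrow> int ^ 'd \<Rightarrow> int ^ 'd \<Rightarrow> (int ^ 'd) list \<Rightarrow> bool" where
  "r_path r m n p \<longleftrightarrow> p \<noteq> [] \<and> hd p = m \<and> last p = n \<and>
     (\<forall>i. Suc i < length p \<longrightarrow> eucl_norm (p ! i - p ! Suc i) \<le> real r)"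

definition boundedly_connected :: "(int ^ 'd) set \<Rightarrow> bool" where
  "boundedly_connected C \<longleftrightarrow>
     (\<exists>r>0. \<forall>m\<in>C. \<forall>n\<in>C. \<exists>p. r_path r m n p \<and> set p \<subseteq> C)"

end

theory Submission
  imports Defs
begin

text \<open>
  If \<open>C\<close> is infinite and connected by steps of length at most \<open>r\<close>, then a path inside \<open>C\<close> from a fixed
  point \<open>m\<close> out to infinity meets every annulus \<open>M + k r < \<parallel>x\<parallel> \<le> M + (k + 1) r\<close> with \<open>\<parallel>m\<parallel> \<le> M\<close>.
  For \<open>s < 1\<close> the point found in the \<open>k\<close>-th annulus contributes at least \<open>1 / ((M + r) (k + 1))\<close>
  to the zeta series, which therefore dominates a multiple of the harmonic series.
\<close>

text \<open>Embedding the lattice into \<open>real ^ 'd\<close> gives access to the triangle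
  inequality and the coordinate bounds of \<open>norm\<close>.\<close>

lemma eucl_norm_eq_norm: "eucl_norm n = norm (\<chi> i. real_of_int (n $ i))"
  by (simp add: eucl_norm_def norm_vec_def L2_set_def)

lemma eucl_norm_0 [simp]: "eucl_norm 0 = 0"
  by (simp add: eucl_norm_def)

lemma eucl_norm_le_add_diff: "eucl_norm n \<le> eucl_norm m + eucl_norm (m - n)"
proof -
  have "(\<chi> i. real_of_int ((m - n) $ i)) = (\<chi> i. real_of_int (m $ i)) - (\<chi> i. real_of_int (n $ i))"
    by (simp add: vec_eq_iff)
  then show ?thesis
    unfolding eucl_norm_eq_norm by (metis norm_minus_commute norm_triangle_sub)
qed

text \<open>Each coordinate is at most the norm in absolute value, so the coordinate functions of
  the points in a ball take values in one finite set of integers.\<close>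

lemma finite_eucl_norm_le: "finite {n :: int ^ 'd. eucl_norm n \<le> R}"
proof -
  have "\<bar>n $ i\<bar> \<le> \<lfloor>R\<rfloor>" if "eucl_norm n \<le> R" for n :: "int ^ 'd" and i
    using component_le_norm_cart[of "\<chi> i. real_of_int (n $ i)" i] that
    by (simp add: eucl_norm_eq_norm le_floor_iff)
  then have "vec_nth ` {n :: int ^ 'd. eucl_norm n \<le> R} \<subseteq> UNIV \<rightarrow>\<^sub>E {- \<lfloor>R\<rfloor>..\<lfloor>R\<rfloor>}"
    by (fastforce simp: abs_le_iff minus_le_iff)
  then have "finite (vec_nth ` {n :: int ^ 'd. eucl_norm n \<le> R})"
    by (rule finite_subset) (simp add: finite_PiE)
  then show ?thesis
    by (rule finite_imageD) (simp add: inj_on_def vec_nth_inject)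
qed

text \<open>The first point of the path outside the ball of radius \<open>t\<close> works: its
  predecessor is still in the ball, and one step adds at most \<open>r\<close> to the norm.\<close>

lemma r_path_crosses_annulus:
  assumes "r_path r m n p" and "eucl_norm m \<le> t" and "t < eucl_norm n"
  shows "\<exists>x\<in>set p. t < eucl_norm x \<and> eucl_norm x \<le> t + r"
proof -
  define j where "j = (LEAST j. j < length p \<and> t < eucl_norm (p ! j))"
  have "length p - 1 < length p \<and> t < eucl_norm (p ! (length p - 1))"
    using assms by (auto simp: r_path_def last_conv_nth)
  then have j: "j < length p" "t < eucl_norm (p ! j)"
    unfolding j_def by (metis (mono_tags, lifting) LeastI)+
  \<comment> \<open>The path starts at \<open>m\<close>, inside the ball, so the first point outside
    has a predecessor.\<close>
  have "j \<noteq> 0"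
    using j assms by (auto simp: r_path_def hd_conv_nth intro: gr0I)
  then obtain i where i: "j = Suc i"
    using not0_implies_Suc by blast
  have "eucl_norm (p ! i) \<le> t"
    using not_less_Least[of i "\<lambda>j. j < length p \<and> t < eucl_norm (p ! j)"] i j(1)
    unfolding j_def by auto
  moreover have "eucl_norm (p ! i - p ! j) \<le> r"
    using assms(1) i j(1) by (simp add: r_path_def)
  ultimately have "eucl_norm (p ! j) \<le> t + r"
    using eucl_norm_le_add_diff[of "p ! j" "p ! i"] by linarith
  then show ?thesis
    using j by auto
qed

text \<open>Balls contain finitely many lattice points, so \<open>C\<close> leaves each of them, and
  a path in \<open>C\<close> from a fixed \<open>m\<close> to a point outside crosses the annulus.
  Starting at \<open>M\<close>, a bound for the norm of \<open>m\<close>, puts \<open>m\<close>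
  inside all the annuli.\<close>

lemma boundedly_connected_meets_annuli:
  assumes "boundedly_connected C" and "infinite C"
  obtains r M q where "0 < r" and "\<And>k. q k \<in> C"
    and "\<And>k. real (M + k * r) < eucl_norm (q k)"
    and "\<And>k. eucl_norm (q k) \<le> real (M + Suc k * r)"
proof -
  obtain r where r: "0 < r" and path: "\<forall>m\<in>C. \<forall>n\<in>C. \<exists>p. r_path r m n p \<and> set p \<subseteq> C"
    using assms(1) unfolding boundedly_connected_def by blast
  obtain m where m: "m \<in> C"
    using assms(2) by fastforce
  obtain M where M: "eucl_norm m \<le> real M"
    using real_arch_simple by blast
  have "\<exists>x\<in>C. real (M + k * r) < eucl_norm x \<and> eucl_norm x \<le> real (M + Suc k * r)" for k
  proof -
    have "\<not> C \<subseteq> {n. eucl_norm n \<le> real (M + k * r)}"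
      using assms(2) finite_eucl_norm_le finite_subset by blast
    then obtain n where n: "n \<in> C" "real (M + k * r) < eucl_norm n"
      by (metis mem_Collect_eq not_le subsetI)
    obtain p where p: "r_path r m n p" "set p \<subseteq> C"
      using path m n(1) by blast
    have "eucl_norm m \<le> real (M + k * r)"
      by (rule order_trans[OF M]) simp
    from r_path_crosses_annulus[OF p(1) this n(2)] p(2) show ?thesis
      by (auto simp: algebra_simps)
  qed
  then obtain q where "\<And>k. q k \<in> C \<and> real (M + k * r) < eucl_norm (q k) \<and> eucl_norm (q k) \<le> real (M + Suc k * r)"
    by metis
  with r that show thesis by blast
qed

text \<open>A sum in \<open>ennreal\<close> is the supremum of its finite partial sums.\<close>

lemma sum_le_zeta:
  assumes "finite F" and "F \<subseteq> A - {0}"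
  shows "ennreal (\<Sum>n\<in>F. eucl_norm n powr (- s)) \<le> zeta A s"
proof -
  have "ennreal (\<Sum>n\<in>F. eucl_norm n powr (- s)) = (\<Sum>n\<in>F. ennreal (eucl_norm n powr (- s)))"
    by simp
  also have "\<dots> \<le> zeta A s"
    unfolding zeta_def using assms by (subst nonneg_infsum_complete) (auto intro: SUP_upper)
  finally show ?thesis .
qed

lemma zeta_infinite_of_boundedly_connected:
  assumes "boundedly_connected C" and "infinite C" and "C \<subseteq> A" and "0 \<le> s" and "s < 1"
  shows "zeta A s = \<infinity>"
proof (rule ccontr)
  assume "zeta A s \<noteq> \<infinity>"
  then obtain B where B: "0 \<le> B" "zeta A s = ennreal B"
    by (cases "zeta A s") auto
  obtain r M q where r: "0 < r" and qC: "\<And>k. q k \<in> C"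
    and q_gt: "\<And>k. real (M + k * r) < eucl_norm (q k)"
    and q_le: "\<And>k. eucl_norm (q k) \<le> real (M + Suc k * r)"
    using boundedly_connected_meets_annuli[OF assms(1,2)] by metis
  \<comment> \<open>The closed outer bound of annulus \<open>k\<close> is the open inner bound of
    annulus \<open>Suc k\<close>. Injectivity of \<open>q\<close> ensures that no term of the zeta
    series is counted twice.\<close>
  have "strict_mono (\<lambda>k. eucl_norm (q k))"
    using q_gt q_le by (intro strict_monoI_Suc) (meson order.strict_trans1)
  then have inj: "inj q"
    by (metis injI strict_mono_eq)
  have pos: "0 < eucl_norm (q k)" for k
    using of_nat_0_le_iff q_gt by (rule order.strict_trans1)
  then have nz: "q k \<noteq> 0" for k
    by (metis eucl_norm_0 less_irrefl)
  have term_ge: "inverse (real (M + r)) * inverse (real (Suc k)) \<le> eucl_norm (q k) powr (- s)" for k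
  proof -
    \<comment> \<open>\<open>D\<close> bounds \<open>M + Suc k * r\<close> from above and factors,
      which isolates the harmonic term. Since \<open>D\<close> is at least 1, raising the exponent
      from -1 to \<open>- s\<close> does not decrease the power.\<close>
    define D where "D = real (M + r) * real (Suc k)"
    have "1 * 1 \<le> D"
      unfolding D_def using r by (intro mult_mono) auto
    have "eucl_norm (q k) \<le> D"
      using q_le[of k] by (rule order_trans) (simp add: D_def algebra_simps)
    have "inverse (real (M + r)) * inverse (real (Suc k)) = D powr (- 1)"
      using \<open>1 * 1 \<le> D\<close> by (simp add: D_def powr_minus)
    also have "\<dots> \<le> D powr (- s)"
      using \<open>1 * 1 \<le> D\<close> \<open>s < 1\<close> by (intro powr_mono) auto
    \<comment> \<open>With exponent \<open>- s \<le> 0\<close> the power is antitone in its positive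
      base.\<close>
    also have "\<dots> \<le> eucl_norm (q k) powr (- s)"
      using \<open>eucl_norm (q k) \<le> D\<close> \<open>0 \<le> s\<close> pos by (intro powr_mono2') auto
    finally show ?thesis .
  qed
  have "(\<Sum>k<N. inverse (real (Suc k))) \<le> real (M + r) * B" for N
  proof -
    have "inverse (real (M + r)) * (\<Sum>k<N. inverse (real (Suc k))) \<le> (\<Sum>k<N. eucl_norm (q k) powr (- s))"
      unfolding sum_distrib_left by (intro sum_mono term_ge)
    also have "\<dots> = (\<Sum>n\<in>q ` {..<N}. eucl_norm n powr (- s))"
      using inj by (simp add: sum.reindex inj_on_subset)
    also have "\<dots> \<le> B"
      using sum_le_zeta[of "q ` {..<N}" A s] qC nz \<open>C \<subseteq> A\<close> B by (auto simp: image_subset_iff)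
    finally show ?thesis
      using r by (simp add: field_simps)
  qed
  \<comment> \<open>Bounded partial sums of nonnegative terms would make the harmonic series
    converge. The criterion sums over \<open>{..n}\<close>, which is rewritten to
    \<open>{..<Suc n}\<close>.\<close>
  then have "summable (\<lambda>k. inverse (real (Suc k)))"
    by (intro bounded_imp_summable[where B = "real (M + r) * B"])
       (simp_all only: flip: lessThan_Suc_atMost, simp)
  then show False
    using not_summable_harmonic[where 'a = real] summable_Suc_iff[of "\<lambda>n. inverse (real n)"] by blast
qed

theorem theorem3p8:
  fixes A :: "(int ^ 'd) set"
  assumes "Dim_zeta A < 1"
  shows "\<not> (\<exists>C. C \<subseteq> A \<and> infinite C \<and> boundedly_connected C)"
proof -
  \<comment> \<open>An infimum below 1 has a member of the set below 1.\<close>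
  obtain s where "0 \<le> s" "zeta A s < \<infinity>" "s < 1"
    using assms unfolding Dim_zeta_def INF_less_iff by auto
  then show ?thesis
    using zeta_infinite_of_boundedly_connected by fastforce
qed

end
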